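(* Let $G$ and $H$ be finite, simple, connected graphs, each with at least two vertices. Then $$\min\{g(G),g(H)\}\le g(G\boxtimes H)\le g(G)\,g(H).$$ Furthermore, both bounds are sharp, i.e. each of the two inequalities holds with equality for some such pair of graphs $G,H$.
   Context: For a connected graph $G$, $d_G(u,v)$ is the distance between $u$ and $v$. The closed interval $I[x,y]$ consists of $x$, $y$ and all vertices lying on some shortest $x$–$y$ path. For $S\subseteq V(G)$, $I[S]=\bigcup_{u,v\in S}I[u,v]$. A set $S$ is geodetic if $I[S]=V(G)$; the geodetic number $g(G)$ is the minimum cardinality of a geodetic set of $G$. The strong product $G\boxtimes H$ has vertex set $V(G)\times V(H)$, with $(g,h)$ and $(g',h')$ adjacent whenever ($g=g'$ and $hh'\in E(H)$), or ($h=h'$ and $gg'\in E(G)$), or ($gg'\in E(G)$ and $hh'\in E(H)$). *)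

theory Defs
  imports "Graph_Theory.Graph_Theory"
begin

text \<open>
  Finite simple graphs are represented by \<^locale>\<open>pair_graph\<close>: finite, loop-free, without parallel
  arcs, and symmetric, so that an undirected edge \<open>uv\<close> is the pair of arcs \<open>(u,v)\<close>, \<open>(v,u)\<close>.
\<close>

definition nontrivial_connected_graph :: "'a pair_pre_digraph \<Rightarrow> bool" where
  "nontrivial_connected_graph G \<longleftrightarrow>
     pair_graph G \<and> Digraph_Component.connected (with_proj G) \<and> 2 \<le> card (pverts G)"

text \<open>The distance is the library's weighted distance, with all arcs of weight one.\<close>

definition gdist :: "'a pair_pre_digraph \<Rightarrow> 'a \<Rightarrow> 'a \<Rightarrow> ereal" where
  "gdist G u v = wf_digraph.\<mu> (with_proj G) (\<lambda>_. 1) u v"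

definition shortest_path :: "'a pair_pre_digraph \<Rightarrow> 'a \<Rightarrow> ('a \<times> 'a) awalk \<Rightarrow> 'a \<Rightarrow> bool" where
  "shortest_path G u p v \<longleftrightarrow>
     pre_digraph.apath (with_proj G) u p v \<and> ereal (real (length p)) = gdist G u v"

definition interval :: "'a pair_pre_digraph \<Rightarrow> 'a \<Rightarrow> 'a \<Rightarrow> 'a set" where
  "interval G x y =
     {x, y} \<union> {w. \<exists>p. shortest_path G x p y \<and> w \<in> set (pre_digraph.awalk_verts (with_proj G) x p)}"

definition interval_set :: "'a pair_pre_digraph \<Rightarrow> 'a set \<Rightarrow> 'a set" where
  "interval_set G S = (\<Union>u\<in>S. \<Union>v\<in>S. interval G u v)"

definition geodetic_set :: "'a pair_pre_digraph \<Rightarrow> 'a set \<Rightarrow> bool" where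
  "geodetic_set G S \<longleftrightarrow> S \<subseteq> pverts G \<and> interval_set G S = pverts G"

definition geodetic_number :: "'a pair_pre_digraph \<Rightarrow> nat" where
  "geodetic_number G = Min (card ` {S. geodetic_set G S})"

definition strong_product ::
    "'a pair_pre_digraph \<Rightarrow> 'b pair_pre_digraph \<Rightarrow> ('a \<times> 'b) pair_pre_digraph"  (infixl \<open>\<boxtimes>\<close> 70) where
  "G \<boxtimes> H =
     \<lparr> pverts = pverts G \<times> pverts H,
       parcs = {((g, h), (g', h')) | g h g' h'.
         g \<in> pverts G \<and> g = g' \<and> (h, h') \<in> parcs H \<or>
         h \<in> pverts H \<and> h = h' \<and> (g, g') \<in> parcs G \<or>
         (g, g') \<in> parcs G \<and> (h, h') \<in> parcs H} \<rparr>"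

end

theory Submission
  imports Defs
begin

text \<open>
  Distances in \<open>G \<boxtimes> H\<close> are maxima of distances in the factors. If \<open>S\<close> is geodetic in \<open>G \<boxtimes> H\<close>, then
  one of its projections is geodetic: were \<open>g\<close> and \<open>h\<close> missed by the two projections, a pair of \<open>S\<close>
  having \<open>(g, h)\<close> in its interval would realise its distance in one coordinate, and the projected
  pair would cover \<open>g\<close> or \<open>h\<close>. Conversely, if \<open>g\<close> lies between \<open>s, s'\<close> and \<open>h\<close> between \<open>t, t'\<close>, take
  the least of the four distances from \<open>g\<close> or \<open>h\<close> to these ends; if it is \<open>d(t, h)\<close>, then \<open>(g, h)\<close>
  lies between \<open>(s, t)\<close> and \<open>(s', t)\<close>, so products of geodetic sets are geodetic.

  The upper bound is attained by \<open>K\<^sub>2 \<boxtimes> K\<^sub>2 = K\<^sub>4\<close>. The lower bound is attained by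
  \<open>K\<^sub>4\<^sub>,\<^sub>4 \<boxtimes> K\<^sub>4\<close>: for two vertices from each side of \<open>K\<^sub>4\<^sub>,\<^sub>4\<close>, every vertex lies strictly between
  two of these four, so a single copy of them already covers the product.
\<close>

section \<open>Distances and intervals\<close>

definition hops :: "'a pair_pre_digraph \<Rightarrow> 'a \<Rightarrow> 'a \<Rightarrow> nat" where
  "hops G u v = (LEAST n. \<exists>p. pre_digraph.awalk (with_proj G) u p v \<and> length p = n)"

context pair_wf_digraph
begin

lemma hops_le_length: "awalk u p v \<Longrightarrow> hops G u v \<le> length p"
  unfolding hops_def by (rule Least_le) blast

lemma shortest_awalkE:
  assumes "u \<rightarrow>\<^sup>*\<^bsub>with_proj G\<^esub> v"
  obtains p where "awalk u p v" "length p = hops G u v"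
proof -
  have "\<exists>n p. awalk u p v \<and> length p = n"
    using assms by (auto simp: reachable_awalk)
  from LeastI_ex[OF this] that show ?thesis unfolding hops_def by blast
qed

lemma hops_le_iff:
  assumes "u \<rightarrow>\<^sup>*\<^bsub>with_proj G\<^esub> v"
  shows "hops G u v \<le> n \<longleftrightarrow> (\<exists>p. awalk u p v \<and> length p \<le> n)"
proof -
  obtain p where "awalk u p v" "length p = hops G u v"
    using shortest_awalkE[OF assms] .
  then show ?thesis by (auto dest: hops_le_length)
qed

lemma hops_triangle:
  assumes "u \<rightarrow>\<^sup>*\<^bsub>with_proj G\<^esub> v" "v \<rightarrow>\<^sup>*\<^bsub>with_proj G\<^esub> w"
  shows "hops G u w \<le> hops G u v + hops G v w"
proof -
  obtain p where p: "awalk u p v" "length p = hops G u v"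
    using shortest_awalkE[OF assms(1)] .
  obtain q where q: "awalk v q w" "length q = hops G v w"
    using shortest_awalkE[OF assms(2)] .
  have "awalk u (p @ q) w" using p(1) q(1) by (rule awalk_appendI)
  from hops_le_length[OF this] p(2) q(2) show ?thesis by simp
qed

lemma hops_eq_0_iff:
  assumes "u \<rightarrow>\<^sup>*\<^bsub>with_proj G\<^esub> v"
  shows "hops G u v = 0 \<longleftrightarrow> u = v"
  using hops_le_iff[OF assms, of 0] reachable_in_verts(1)[OF assms] by (auto simp: awalk_Nil_iff)

lemma hops_self [simp]: "u \<in> pverts G \<Longrightarrow> hops G u u = 0"
  by (simp add: hops_eq_0_iff)

lemma hops_le_1_iff:
  assumes "u \<rightarrow>\<^sup>*\<^bsub>with_proj G\<^esub> v"
  shows "hops G u v \<le> 1 \<longleftrightarrow> u = v \<or> (u, v) \<in> parcs G"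
proof -
  have "(\<exists>p. awalk u p v \<and> length p \<le> 1) \<longleftrightarrow> awalk u [] v \<or> (\<exists>e. awalk u [e] v)"
    by (auto simp: le_Suc_eq length_Suc_conv)
  then show ?thesis
    using reachable_in_verts[OF assms]
    by (auto simp: hops_le_iff[OF assms] awalk_simps)
qed

lemma gdist_eq_hops:
  assumes "u \<rightarrow>\<^sup>*\<^bsub>with_proj G\<^esub> v"
  shows "gdist G u v = ereal (real (hops G u v))"
proof -
  have cost: "awalk_cost (\<lambda>_. 1) p = real (length p)" for p :: "('a \<times> 'a) list"
    by (induction p) auto
  obtain p where "awalk u p v" "length p = hops G u v"
    using shortest_awalkE[OF assms] .
  then show ?thesis
    unfolding gdist_def \<mu>_def cost
    by (intro antisym INF_greatest INF_lower2[of p]) (simp_all add: hops_le_length)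
qed

lemma apath_if_length_eq_hops:
  assumes "awalk u p v" "length p = hops G u v"
  shows "apath u p v"
proof (rule ccontr)
  assume "\<not> apath u p v"
  with assms(1) have "\<not> distinct (awalk_verts u p)" by (simp add: apath_def)
  with assms(1) obtain q r s w where
    decomp: "p = q @ r @ s" "0 < length r" "awalk u q w" "awalk w s v"
    using awalk_not_distinct_decomp by metis
  from decomp(3,4) have "awalk u (q @ s) v" by (rule awalk_appendI)
  then have "hops G u v \<le> length (q @ s)" by (rule hops_le_length)
  also have "\<dots> < length p" using decomp(1,2) by simp
  finally show False using assms(2) by simp
qed

lemma shortest_path_iff:
  assumes "u \<rightarrow>\<^sup>*\<^bsub>with_proj G\<^esub> v"
  shows "shortest_path G u p v \<longleftrightarrow> awalk u p v \<and> length p = hops G u v"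
  unfolding shortest_path_def gdist_eq_hops[OF assms]
  using apath_if_length_eq_hops awalkI_apath by auto

end

lemma (in pair_sym_digraph) hops_commute: "hops G u v = hops G v u"
proof -
  have "length (rev_path p) = length p" for p :: "('a \<times> 'a) awalk"
    by (induction p) auto
  then have "(\<exists>p. awalk u p v \<and> length p = n) \<longleftrightarrow> (\<exists>p. awalk v p u \<and> length p = n)" for n
    by (metis awalk_rev_path)
  then show ?thesis unfolding hops_def by simp
qed

locale connected_pair_graph = pair_graph +
  assumes connected: "Digraph_Component.connected (with_proj G)"

lemma (in pair_graph) connected_pair_graphI:
  assumes "pverts G \<noteq> {}"
    and "\<And>u v. u \<in> pverts G \<Longrightarrow> v \<in> pverts G \<Longrightarrow> u \<rightarrow>\<^sup>*\<^bsub>with_proj G\<^esub> v"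
  shows "connected_pair_graph G"
proof
  show "Digraph_Component.connected (with_proj G)"
    using assms reachable_mk_symmetricI
    by (simp add: Digraph_Component.connected_def strongly_connected_def)
qed

context connected_pair_graph
begin

lemma reachable [simp]: "u \<in> pverts G \<Longrightarrow> v \<in> pverts G \<Longrightarrow> u \<rightarrow>\<^sup>*\<^bsub>with_proj G\<^esub> v"
  using symmetric_connected_imp_strongly_connected[OF sym_arcs connected]
  by (simp add: strongly_connected_def)

lemma mem_interval_iff:
  assumes uv: "u \<in> pverts G" "v \<in> pverts G"
  shows "w \<in> interval G u v \<longleftrightarrow> w \<in> pverts G \<and> hops G u w + hops G w v = hops G u v"
proof
  assume w: "w \<in> interval G u v"
  show "w \<in> pverts G \<and> hops G u w + hops G w v = hops G u v"
  proof (cases "w \<in> {u, v}")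
    case True
    with uv show ?thesis using hops_eq_0_iff by auto
  next
    case False
    with w uv obtain p where p: "awalk u p v" "length p = hops G u v" "w \<in> set (awalk_verts u p)"
      by (auto simp: interval_def shortest_path_iff)
    obtain q r where qr: "p = q @ r" "awalk u q w" "awalk w r v"
      using awalk_decomp[OF p(1,3)] by blast
    have "w \<in> pverts G" using awalk_hd_in_verts[OF qr(3)] by simp
    moreover have "hops G u w + hops G w v \<le> hops G u v"
      using hops_le_length[OF qr(2)] hops_le_length[OF qr(3)] p(2) qr(1) by simp
    ultimately show ?thesis using hops_triangle[of u w v] uv by simp
  qed
next
  assume w: "w \<in> pverts G \<and> hops G u w + hops G w v = hops G u v"
  with uv have reach: "u \<rightarrow>\<^sup>*\<^bsub>with_proj G\<^esub> w" "w \<rightarrow>\<^sup>*\<^bsub>with_proj G\<^esub> v" by simp_all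
  obtain q where q: "awalk u q w" "length q = hops G u w" using shortest_awalkE[OF reach(1)] .
  obtain r where r: "awalk w r v" "length r = hops G w v" using shortest_awalkE[OF reach(2)] .
  have "awalk u (q @ r) v" using q(1) r(1) by (rule awalk_appendI)
  then have "shortest_path G u (q @ r) v" using uv w q(2) r(2) by (simp add: shortest_path_iff)
  moreover have "w \<in> set (awalk_verts u (q @ r))"
    using hd_in_awalk_verts(1)[OF r(1)] set_awalk_verts_append[OF q(1) r(1)] by simp
  ultimately show "w \<in> interval G u v" unfolding interval_def by auto
qed

end

section \<open>Geodetic sets\<close>

context connected_pair_graph
begin

lemma interval_subset_verts: "u \<in> pverts G \<Longrightarrow> v \<in> pverts G \<Longrightarrow> interval G u v \<subseteq> pverts G"
  by (auto simp: mem_interval_iff)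

lemma geodetic_set_iff:
  "geodetic_set G S \<longleftrightarrow>
     S \<subseteq> pverts G \<and> (\<forall>w\<in>pverts G. \<exists>u\<in>S. \<exists>v\<in>S. w \<in> interval G u v)"
proof -
  have "interval_set G S \<subseteq> pverts G" if "S \<subseteq> pverts G"
    unfolding interval_set_def using that by (intro UN_least interval_subset_verts) auto
  then have "interval_set G S = pverts G \<longleftrightarrow> pverts G \<subseteq> interval_set G S" if "S \<subseteq> pverts G"
    using that by blast
  moreover have "pverts G \<subseteq> interval_set G S \<longleftrightarrow>
      (\<forall>w\<in>pverts G. \<exists>u\<in>S. \<exists>v\<in>S. w \<in> interval G u v)"
    unfolding interval_set_def by blast
  ultimately show ?thesis unfolding geodetic_set_def by blast
qed

lemma geodetic_setE:
  assumes "geodetic_set G S" "w \<in> pverts G"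
  obtains u v where "u \<in> S" "v \<in> S" "w \<in> interval G u v"
  using assms that unfolding geodetic_set_iff by blast

lemma not_geodetic_setE:
  assumes "\<not> geodetic_set G S" "S \<subseteq> pverts G"
  obtains w where "w \<in> pverts G" "\<And>u v. u \<in> S \<Longrightarrow> v \<in> S \<Longrightarrow> w \<notin> interval G u v"
  using assms that unfolding geodetic_set_iff by blast

lemma geodetic_set_verts: "geodetic_set G (pverts G)"
  by (auto simp: geodetic_set_iff interval_def)

lemma finite_geodetic_set: "geodetic_set G S \<Longrightarrow> finite S"
  using pair_finite_verts by (auto simp: geodetic_set_def intro: finite_subset)

lemma finite_geodetic_sets: "finite {S. geodetic_set G S}"
  by (rule finite_subset[of _ "Pow (pverts G)"])
     (auto simp: geodetic_set_def pair_finite_verts)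

lemma geodetic_number_le: "geodetic_set G S \<Longrightarrow> geodetic_number G \<le> card S"
  unfolding geodetic_number_def by (intro Min_le) (auto simp: finite_geodetic_sets)

lemma minimum_geodetic_setE:
  obtains S where "geodetic_set G S" "card S = geodetic_number G"
proof -
  have "geodetic_number G \<in> card ` {S. geodetic_set G S}"
    unfolding geodetic_number_def using finite_geodetic_sets geodetic_set_verts
    by (intro Min_in) auto
  with that show ?thesis by auto
qed

end

section \<open>Distances in strong products\<close>

text \<open>
  Allowing a walk to stay put makes the step relation of \<open>G \<boxtimes> H\<close> the product of those of the factors.
\<close>

definition lazy_step :: "'a pair_pre_digraph \<Rightarrow> 'a rel" where
  "lazy_step G = Id_on (pverts G) \<union> parcs G"

lemma (in pair_wf_digraph) lazy_step_pow_iff_awalk: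
  assumes "u \<in> pverts G"
  shows "(u, v) \<in> lazy_step G ^^ n \<longleftrightarrow> (\<exists>p. awalk u p v \<and> length p \<le> n)"
  using assms
proof (induction n arbitrary: u)
  case 0
  then show ?case by (auto simp: awalk_Nil_iff)
next
  case (Suc n)
  have step_in_verts: "w \<in> pverts G" if "(u, w) \<in> lazy_step G" for w
    using that by (auto simp: lazy_step_def dest: wellformed')
  have "(u, v) \<in> lazy_step G ^^ Suc n \<longleftrightarrow>
      (\<exists>w. (u, w) \<in> lazy_step G \<and> (w, v) \<in> lazy_step G ^^ n)"
    using relpow_commute[of "lazy_step G" n] by (metis relcomp.simps relpow.simps(2))
  also have "\<dots> \<longleftrightarrow> (\<exists>w. (u, w) \<in> lazy_step G \<and> (\<exists>p. awalk w p v \<and> length p \<le> n))"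
    using Suc.IH step_in_verts by blast
  also have "\<dots> \<longleftrightarrow> (\<exists>p. awalk u p v \<and> length p \<le> n) \<or>
      (\<exists>w p. awalk u ((u, w) # p) v \<and> length ((u, w) # p) \<le> Suc n)"
    using Suc.prems by (auto simp: lazy_step_def awalk_Cons_iff)
  also have "\<dots> \<longleftrightarrow> (\<exists>p. awalk u p v \<and> length p \<le> Suc n)"
  proof (intro iffI; elim disjE exE conjE)
    fix p assume "awalk u p v" "length p \<le> Suc n"
    then show "(\<exists>p. awalk u p v \<and> length p \<le> n) \<or>
        (\<exists>w p. awalk u ((u, w) # p) v \<and> length ((u, w) # p) \<le> Suc n)"
      by (cases p) (auto simp: awalk_Cons_iff)
  qed auto
  finally show ?case .
qed

lemma lazy_step_strong_product:
  "((x, y), (x', y')) \<in> lazy_step (G \<boxtimes> H) \<longleftrightarrow> (x, x') \<in> lazy_step G \<and> (y, y') \<in> lazy_step H"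
  by (simp add: lazy_step_def Id_on_iff strong_product_def) blast

lemma lazy_step_pow_strong_product:
  "((x, y), (x', y')) \<in> lazy_step (G \<boxtimes> H) ^^ n \<longleftrightarrow>
     (x, x') \<in> lazy_step G ^^ n \<and> (y, y') \<in> lazy_step H ^^ n"
  by (induction n arbitrary: x' y') (auto simp: relcomp_unfold lazy_step_strong_product)

lemma verts_strong_product [simp]: "pverts (G \<boxtimes> H) = pverts G \<times> pverts H"
  by (simp add: strong_product_def)

lemma pair_graph_strong_product:
  assumes "pair_graph G" "pair_graph H"
  shows "pair_graph (G \<boxtimes> H)"
proof -
  interpret G: pair_graph G by fact
  interpret H: pair_graph H by fact
  have arcs: "parcs (G \<boxtimes> H) \<subseteq> (pverts G \<times> pverts H) \<times> (pverts G \<times> pverts H)"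
    by (auto simp: strong_product_def dest: G.wellformed' H.wellformed')
  show ?thesis
  proof
    fix e assume e: "e \<in> parcs (G \<boxtimes> H)"
    with arcs show "fst e \<in> pverts (G \<boxtimes> H)" "snd e \<in> pverts (G \<boxtimes> H)" by auto
    from e show "fst e \<noteq> snd e"
      by (auto simp: strong_product_def dest: G.no_loops' H.no_loops')
  next
    show "finite (pverts (G \<boxtimes> H))" by (simp add: G.pair_finite_verts H.pair_finite_verts)
    then show "finite (parcs (G \<boxtimes> H))"
      by (intro finite_subset[OF arcs]) simp
    show "symmetric (with_proj (G \<boxtimes> H))"
      by (auto simp: symmetric_def sym_def strong_product_def
          dest: G.arcs_symmetric H.arcs_symmetric)
  qed
qed

locale connected_pair_graph_pair =
  G: connected_pair_graph G + H: connected_pair_graph H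
  for G :: "'a pair_pre_digraph" and H :: "'b pair_pre_digraph"
begin

lemma awalk_strong_product_iff:
  assumes "x \<in> pverts G" "x' \<in> pverts G" "y \<in> pverts H" "y' \<in> pverts H"
  shows "(\<exists>p. pre_digraph.awalk (with_proj (G \<boxtimes> H)) (x, y) p (x', y') \<and> length p \<le> n) \<longleftrightarrow>
    hops G x x' \<le> n \<and> hops H y y' \<le> n"
proof -
  interpret GH: pair_graph "G \<boxtimes> H"
    by (intro pair_graph_strong_product G.pair_graph H.pair_graph)
  show ?thesis
    using assms
    by (simp add: GH.lazy_step_pow_iff_awalk[symmetric] lazy_step_pow_strong_product
        G.lazy_step_pow_iff_awalk H.lazy_step_pow_iff_awalk G.hops_le_iff H.hops_le_iff)
qed

sublocale GH: connected_pair_graph "G \<boxtimes> H"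
proof -
  interpret GH: pair_graph "G \<boxtimes> H"
    by (intro pair_graph_strong_product G.pair_graph H.pair_graph)
  show "connected_pair_graph (G \<boxtimes> H)"
  proof (rule GH.connected_pair_graphI)
    show "pverts (G \<boxtimes> H) \<noteq> {}" using G.connected H.connected by (simp add: connected_conv)
    fix u v assume "u \<in> pverts (G \<boxtimes> H)" "v \<in> pverts (G \<boxtimes> H)"
    then obtain x y x' y' where "u = (x, y)" "v = (x', y')"
      "x \<in> pverts G" "x' \<in> pverts G" "y \<in> pverts H" "y' \<in> pverts H"
      by auto
    then show "u \<rightarrow>\<^sup>*\<^bsub>with_proj (G \<boxtimes> H)\<^esub> v"
      using awalk_strong_product_iff[of x x' y y' "max (hops G x x') (hops H y y')"]
      by (auto simp: GH.reachable_awalk)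
  qed
qed

lemma hops_strong_product:
  assumes "x \<in> pverts G" "x' \<in> pverts G" "y \<in> pverts H" "y' \<in> pverts H"
  shows "hops (G \<boxtimes> H) (x, y) (x', y') = max (hops G x x') (hops H y y')"
proof -
  have "hops (G \<boxtimes> H) (x, y) (x', y') \<le> n \<longleftrightarrow> max (hops G x x') (hops H y y') \<le> n" for n
    using awalk_strong_product_iff[OF assms] assms by (simp add: GH.hops_le_iff)
  then show ?thesis by (meson le_antisym order_refl)
qed

end

section \<open>Geodetic sets of strong products\<close>

context connected_pair_graph_pair
begin

lemma mem_interval_strong_product_fstI:
  assumes "g \<in> interval G s s'" "s \<in> pverts G" "s' \<in> pverts G"
    and "t \<in> pverts H" "h \<in> pverts H" "hops H t h \<le> hops G s g" "hops H h t \<le> hops G g s'"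
  shows "(g, h) \<in> interval (G \<boxtimes> H) (s, t) (s', t)"
  using assms
  by (simp add: G.mem_interval_iff GH.mem_interval_iff hops_strong_product)

lemma mem_interval_strong_product_sndI:
  assumes "h \<in> interval H t t'" "t \<in> pverts H" "t' \<in> pverts H"
    and "s \<in> pverts G" "g \<in> pverts G" "hops G s g \<le> hops H t h" "hops G g s \<le> hops H h t'"
  shows "(g, h) \<in> interval (G \<boxtimes> H) (s, t) (s, t')"
  using assms
  by (simp add: H.mem_interval_iff GH.mem_interval_iff hops_strong_product)

lemma mem_interval_strong_productD:
  assumes "(g, h) \<in> interval (G \<boxtimes> H) (x, y) (x', y')"
    and "x \<in> pverts G" "x' \<in> pverts G" "y \<in> pverts H" "y' \<in> pverts H"
  shows "g \<in> interval G x x' \<or> h \<in> interval H y y'"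
proof -
  have gh: "g \<in> pverts G" "h \<in> pverts H"
    and max: "max (hops G x g) (hops H y h) + max (hops G g x') (hops H h y') =
      max (hops G x x') (hops H y y')"
    using assms by (auto simp: GH.mem_interval_iff hops_strong_product)
  have "hops G x x' \<le> hops G x g + hops G g x'" "hops H y y' \<le> hops H y h + hops H h y'"
    using assms(2-5) gh by (simp_all add: G.hops_triangle H.hops_triangle)
  with max have "hops G x g + hops G g x' = hops G x x' \<or> hops H y h + hops H h y' = hops H y y'"
    by linarith
  with assms(2-5) gh show ?thesis by (auto simp: G.mem_interval_iff H.mem_interval_iff)
qed

lemma geodetic_set_Times:
  assumes S: "geodetic_set G S" and T: "geodetic_set H T"
  shows "geodetic_set (G \<boxtimes> H) (S \<times> T)"
  unfolding GH.geodetic_set_iff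
proof (intro conjI ballI)
  have sub: "S \<subseteq> pverts G" "T \<subseteq> pverts H" using S T by (auto simp: geodetic_set_def)
  then show "S \<times> T \<subseteq> pverts (G \<boxtimes> H)" by auto
  fix w assume "w \<in> pverts (G \<boxtimes> H)"
  then obtain g h where w: "w = (g, h)" and gh: "g \<in> pverts G" "h \<in> pverts H" by auto
  obtain s s' where s: "s \<in> S" "s' \<in> S" "g \<in> interval G s s'"
    using G.geodetic_setE[OF S gh(1)] .
  obtain t t' where t: "t \<in> T" "t' \<in> T" "h \<in> interval H t t'"
    using H.geodetic_setE[OF T gh(2)] .
  have verts: "s \<in> pverts G" "s' \<in> pverts G" "t \<in> pverts H" "t' \<in> pverts H"
    using s t sub by auto
  have commute: "hops H h t = hops H t h" "hops H t' h = hops H h t'"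
    "hops G g s = hops G s g" "hops G s' g = hops G g s'"
    by (rule H.hops_commute G.hops_commute)+
  note via_G = mem_interval_strong_product_fstI[OF s(3) verts(1,2) _ gh(2)]
    and via_H = mem_interval_strong_product_sndI[OF t(3) verts(3,4) _ gh(1)]
  consider "hops H t h \<le> hops G s g \<and> hops H t h \<le> hops G g s'"
    | "hops H h t' \<le> hops G s g \<and> hops H h t' \<le> hops G g s'"
    | "hops G s g \<le> hops H t h \<and> hops G s g \<le> hops H h t'"
    | "hops G g s' \<le> hops H t h \<and> hops G g s' \<le> hops H h t'"
    by linarith
  then have "(g, h) \<in> interval (G \<boxtimes> H) (s, t) (s', t) \<or> (g, h) \<in> interval (G \<boxtimes> H) (s, t') (s', t') \<or>
      (g, h) \<in> interval (G \<boxtimes> H) (s, t) (s, t') \<or> (g, h) \<in> interval (G \<boxtimes> H) (s', t) (s', t')"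
    using via_G[of t] via_G[of t'] via_H[of s] via_H[of s'] verts commute by cases simp_all
  with s(1,2) t(1,2) w show "\<exists>u\<in>S \<times> T. \<exists>v\<in>S \<times> T. w \<in> interval (G \<boxtimes> H) u v"
    by blast
qed

lemma geodetic_set_Times_singleton:
  assumes "S \<subseteq> pverts G" "t \<in> pverts H"
    and "\<And>g h. g \<in> pverts G \<Longrightarrow> h \<in> pverts H \<Longrightarrow>
      \<exists>s\<in>S. \<exists>s'\<in>S. g \<in> interval G s s' \<and> hops H t h \<le> hops G s g \<and> hops H h t \<le> hops G g s'"
  shows "geodetic_set (G \<boxtimes> H) (S \<times> {t})"
  unfolding GH.geodetic_set_iff
proof (intro conjI ballI)
  show "S \<times> {t} \<subseteq> pverts (G \<boxtimes> H)" using assms(1,2) by auto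
  fix w assume "w \<in> pverts (G \<boxtimes> H)"
  then obtain g h where w: "w = (g, h)" "g \<in> pverts G" "h \<in> pverts H" by auto
  then obtain s s' where "s \<in> S" "s' \<in> S" "g \<in> interval G s s'"
    "hops H t h \<le> hops G s g" "hops H h t \<le> hops G g s'"
    using assms(3) by blast
  with w assms(1,2) have "w \<in> interval (G \<boxtimes> H) (s, t) (s', t)"
    by (auto intro: mem_interval_strong_product_fstI)
  with \<open>s \<in> S\<close> \<open>s' \<in> S\<close> show "\<exists>u\<in>S \<times> {t}. \<exists>v\<in>S \<times> {t}. w \<in> interval (G \<boxtimes> H) u v" by blast
qed

lemma geodetic_set_projection:
  assumes S: "geodetic_set (G \<boxtimes> H) S"
  shows "geodetic_set G (fst ` S) \<or> geodetic_set H (snd ` S)"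
proof (rule ccontr)
  assume "\<not> ?thesis"
  then have not_geodetic: "\<not> geodetic_set G (fst ` S)" "\<not> geodetic_set H (snd ` S)" by simp_all
  have proj: "fst ` S \<subseteq> pverts G" "snd ` S \<subseteq> pverts H"
    using S by (auto simp: geodetic_set_def)
  obtain g where g: "g \<in> pverts G" "\<And>u v. u \<in> fst ` S \<Longrightarrow> v \<in> fst ` S \<Longrightarrow> g \<notin> interval G u v"
    using G.not_geodetic_setE[OF not_geodetic(1) proj(1)] by blast
  obtain h where h: "h \<in> pverts H" "\<And>u v. u \<in> snd ` S \<Longrightarrow> v \<in> snd ` S \<Longrightarrow> h \<notin> interval H u v"
    using H.not_geodetic_setE[OF not_geodetic(2) proj(2)] by blast
  have "(g, h) \<in> pverts (G \<boxtimes> H)" using g(1) h(1) by simp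
  then obtain x y x' y' where pair: "(x, y) \<in> S" "(x', y') \<in> S"
    and mem: "(g, h) \<in> interval (G \<boxtimes> H) (x, y) (x', y')"
    using GH.geodetic_setE[OF S] by (metis surj_pair)
  have in_proj: "x \<in> fst ` S" "x' \<in> fst ` S" "y \<in> snd ` S" "y' \<in> snd ` S"
    using pair by force+
  have "g \<in> interval G x x' \<or> h \<in> interval H y y'"
    using mem by (rule mem_interval_strong_productD) (use in_proj proj in blast)+
  with g(2) h(2) in_proj show False by blast
qed

theorem geodetic_number_strong_product_le:
  "geodetic_number (G \<boxtimes> H) \<le> geodetic_number G * geodetic_number H"
proof -
  obtain S where S: "geodetic_set G S" "card S = geodetic_number G"
    using G.minimum_geodetic_setE .
  obtain T where T: "geodetic_set H T" "card T = geodetic_number H"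
    using H.minimum_geodetic_setE .
  show ?thesis
    using GH.geodetic_number_le[OF geodetic_set_Times[OF S(1) T(1)]] S T
    by (simp add: card_cartesian_product)
qed

theorem min_geodetic_number_le_strong_product:
  "min (geodetic_number G) (geodetic_number H) \<le> geodetic_number (G \<boxtimes> H)"
proof -
  obtain S where S: "geodetic_set (G \<boxtimes> H) S" "card S = geodetic_number (G \<boxtimes> H)"
    using GH.minimum_geodetic_setE .
  have "card (fst ` S) \<le> card S" "card (snd ` S) \<le> card S"
    using GH.finite_geodetic_set[OF S(1)] by (auto intro: card_image_le)
  then show ?thesis
    using geodetic_set_projection[OF S(1)] G.geodetic_number_le[of "fst ` S"]
      H.geodetic_number_le[of "snd ` S"] S(2) by linarith
qed

end

theorem geodetic_number_strong_product_bounds: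
  assumes "nontrivial_connected_graph G" "nontrivial_connected_graph H"
  shows "min (geodetic_number G) (geodetic_number H) \<le> geodetic_number (G \<boxtimes> H)"
    and "geodetic_number (G \<boxtimes> H) \<le> geodetic_number G * geodetic_number H"
proof -
  interpret connected_pair_graph_pair G H
    using assms
    by (simp add: connected_pair_graph_pair_def connected_pair_graph_def
        connected_pair_graph_axioms_def nontrivial_connected_graph_def)
  show "min (geodetic_number G) (geodetic_number H) \<le> geodetic_number (G \<boxtimes> H)"
    by (rule min_geodetic_number_le_strong_product)
  show "geodetic_number (G \<boxtimes> H) \<le> geodetic_number G * geodetic_number H"
    by (rule geodetic_number_strong_product_le)
qed

section \<open>Complete and complete bipartite graphs\<close>

lemma connected_pair_graph_complete:
  assumes "K\<^bsub>n\<^esub> (with_proj G)" "0 < n"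
  shows "connected_pair_graph G"
proof -
  interpret pair_graph G using assms(1) by (rule pair_graphI_complete)
  have "u \<rightarrow>\<^sup>*\<^bsub>with_proj G\<^esub> v" if "u \<in> pverts G" "v \<in> pverts G" for u v
    using that assms(1) by (cases "u = v") (auto simp: complete_digraph_pair_def)
  moreover have "pverts G \<noteq> {}" using assms by (auto simp: complete_digraph_pair_def)
  ultimately show ?thesis by (intro connected_pair_graphI)
qed

lemma (in connected_pair_graph) hops_le_1_if_complete:
  assumes "K\<^bsub>n\<^esub> (with_proj G)" "u \<in> pverts G" "v \<in> pverts G"
  shows "hops G u v \<le> 1"
  using assms by (subst hops_le_1_iff) (auto simp: complete_digraph_pair_def)

lemma geodetic_number_complete:
  assumes K: "K\<^bsub>n\<^esub> (with_proj G)" and "0 < n"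
  shows "geodetic_number G = n"
proof -
  interpret connected_pair_graph G using assms by (rule connected_pair_graph_complete)
  obtain S where S: "geodetic_set G S" "card S = geodetic_number G"
    using minimum_geodetic_setE .
  then have sub: "S \<subseteq> pverts G" by (simp add: geodetic_set_def)
  have "w \<in> S" if w: "w \<in> pverts G" for w
  proof -
    obtain u v where uv: "u \<in> S" "v \<in> S" "w \<in> interval G u v"
      using geodetic_setE[OF S(1) w] .
    with sub have verts: "u \<in> pverts G" "v \<in> pverts G" by auto
    with K have "hops G u v \<le> 1" by (rule hops_le_1_if_complete)
    with uv(3) verts have "hops G u w = 0 \<or> hops G w v = 0" by (auto simp: mem_interval_iff)
    with uv(1,2) verts w show ?thesis by (auto simp: hops_eq_0_iff)
  qed
  with sub have "S = pverts G" by blast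
  with S(2) K show ?thesis by (simp add: complete_digraph_pair_def)
qed

lemma complete_strong_product:
  assumes "K\<^bsub>m\<^esub> (with_proj G)" "K\<^bsub>n\<^esub> (with_proj H)"
  shows "K\<^bsub>m * n\<^esub> (with_proj (G \<boxtimes> H))"
  using assms
  by (auto simp: complete_digraph_pair_def strong_product_def card_cartesian_product)

locale complete_bipartite_graph = pair_graph G
  for G :: "'a pair_pre_digraph" and U V :: "'a set" +
  assumes verts_eq: "pverts G = U \<union> V"
    and disjoint: "U \<inter> V = {}"
    and arcs_eq: "parcs G = U \<times> V \<union> V \<times> U"
    and sides_nonempty: "U \<noteq> {}" "V \<noteq> {}"
begin

lemma swap: "complete_bipartite_graph G V U"
  by unfold_locales (use verts_eq disjoint arcs_eq sides_nonempty in auto)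

sublocale connected_pair_graph G
proof (rule connected_pair_graphI)
  show "pverts G \<noteq> {}" using verts_eq sides_nonempty by simp
  fix u v assume uv: "u \<in> pverts G" "v \<in> pverts G"
  show "u \<rightarrow>\<^sup>*\<^bsub>with_proj G\<^esub> v"
  proof (cases "(u, v) \<in> parcs G")
    case True
    then show ?thesis by simp
  next
    case False
    with uv sides_nonempty obtain x where "(u, x) \<in> parcs G" "(x, v) \<in> parcs G"
      unfolding verts_eq arcs_eq by blast
    then have "u \<rightarrow>\<^sup>*\<^bsub>with_proj G\<^esub> x" "x \<rightarrow>\<^sup>*\<^bsub>with_proj G\<^esub> v" by simp_all
    then show ?thesis by (rule reachable_trans)
  qed
qed

lemma hops_eq:
  assumes "u \<in> pverts G" "v \<in> pverts G"
  shows "hops G u v = (if u = v then 0 else if u \<in> U \<longleftrightarrow> v \<in> U then 2 else 1)"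
proof -
  have adjacent: "(x, y) \<in> parcs G \<longleftrightarrow> (x \<in> U) \<noteq> (y \<in> U)"
    if "x \<in> pverts G" "y \<in> pverts G" for x y
    using that disjoint by (auto simp: verts_eq arcs_eq)
  have le_1: "hops G x y \<le> 1 \<longleftrightarrow> x = y \<or> (x \<in> U) \<noteq> (y \<in> U)"
    if "x \<in> pverts G" "y \<in> pverts G" for x y
    using that adjacent by (subst hops_le_1_iff) simp_all
  have "hops G u v \<le> 2" if "u \<in> U \<longleftrightarrow> v \<in> U"
  proof -
    obtain x where x: "x \<in> pverts G" "(x \<in> U) \<noteq> (u \<in> U)"
      using sides_nonempty disjoint verts_eq by blast
    then have "hops G u x \<le> 1" "hops G x v \<le> 1" using that assms le_1 by auto
    with hops_triangle[of u x v] x(1) assms show ?thesis by simp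
  qed
  with le_1[OF assms] hops_eq_0_iff[of u v] assms show ?thesis by auto
qed

lemma mem_interval_opposite_side:
  assumes "u \<in> U" "v \<in> U" "u \<noteq> v" "w \<in> V"
  shows "w \<in> interval G u v"
  using assms disjoint by (auto simp: mem_interval_iff verts_eq hops_eq)

lemma card_geodetic_set_Int_ge_2:
  assumes S: "geodetic_set G S" and "\<not> U \<subseteq> S"
  shows "2 \<le> card (S \<inter> V)"
proof -
  obtain w where w: "w \<in> U" "w \<notin> S" using assms(2) by blast
  then have w_vert: "w \<in> pverts G" by (simp add: verts_eq)
  obtain u v where uv: "u \<in> S" "v \<in> S" "w \<in> interval G u v"
    using geodetic_setE[OF S w_vert] .
  with S have verts: "u \<in> pverts G" "v \<in> pverts G" by (auto simp: geodetic_set_def)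
  have "hops G u w + hops G w v = hops G u v" using uv verts by (simp add: mem_interval_iff)
  moreover have "w \<noteq> u" "w \<noteq> v" using w(2) uv by auto
  ultimately have "u \<notin> U" "v \<notin> U" "u \<noteq> v"
    using verts w_vert w(1) by (auto simp: hops_eq split: if_splits)
  with uv verts have "{u, v} \<subseteq> S \<inter> V" "card {u, v} = 2" by (auto simp: verts_eq)
  then show ?thesis
    using finite_geodetic_set[OF S] by (metis card_mono finite_Int)
qed

lemma card_geodetic_set_ge:
  assumes S: "geodetic_set G S"
  shows "min 4 (min (card U) (card V)) \<le> card S"
proof (cases "U \<subseteq> S \<or> V \<subseteq> S")
  case True
  then have "card U \<le> card S \<or> card V \<le> card S"
    using card_mono[OF finite_geodetic_set[OF S]] by blast
  then show ?thesis by linarith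
next
  case False
  then have "2 \<le> card (S \<inter> U)" "2 \<le> card (S \<inter> V)"
    using card_geodetic_set_Int_ge_2[OF S]
      complete_bipartite_graph.card_geodetic_set_Int_ge_2[OF swap S] by simp_all
  moreover have "card (S \<inter> U) + card (S \<inter> V) = card ((S \<inter> U) \<union> (S \<inter> V))"
    using finite_geodetic_set[OF S] disjoint by (intro card_Un_disjoint[symmetric]) auto
  moreover have "(S \<inter> U) \<union> (S \<inter> V) = S" using S by (auto simp: geodetic_set_def verts_eq)
  ultimately show ?thesis by simp
qed

lemma strictly_between_two_per_sideE:
  assumes A: "A \<subseteq> U" "card A = 2" and B: "B \<subseteq> V" "card B = 2" and w: "w \<in> pverts G"
  obtains u v where "u \<in> A \<union> B" "v \<in> A \<union> B" "w \<in> interval G u v" "u \<noteq> w" "v \<noteq> w"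
proof (cases "w \<in> U")
  case True
  obtain u v where "B = {u, v}" "u \<noteq> v" using B(2) by (auto simp: card_2_iff)
  with True B(1) disjoint show ?thesis
    using complete_bipartite_graph.mem_interval_opposite_side[OF swap, of u v w]
    by (intro that[of u v]) auto
next
  case False
  obtain u v where "A = {u, v}" "u \<noteq> v" using A(2) by (auto simp: card_2_iff)
  with False w A(1) show ?thesis
    using mem_interval_opposite_side[of u v w]
    by (intro that[of u v]) (auto simp: verts_eq)
qed

end

lemma complete_bipartite_digraphE:
  assumes "K\<^bsub>m,n\<^esub> (with_proj G)" "0 < m" "0 < n"
  obtains U V where "complete_bipartite_graph G U V" "card U = m" "card V = n"
proof -
  obtain U V where UV: "pverts G = U \<union> V" "U \<inter> V = {}" "card U = m" "card V = n"
    "parcs G = U \<times> V \<union> V \<times> U"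
    using assms(1) by (auto simp: complete_bipartite_digraph_pair_def)
  with assms have "complete_bipartite_graph G U V"
    by (auto simp: complete_bipartite_graph_def complete_bipartite_graph_axioms_def
        intro: pair_graphI_complete_bipartite)
  with UV that show ?thesis by blast
qed

lemma geodetic_number_complete_bipartite_ge:
  assumes "K\<^bsub>m,n\<^esub> (with_proj G)" "0 < m" "0 < n"
  shows "min 4 (min m n) \<le> geodetic_number G"
proof -
  obtain U V where "complete_bipartite_graph G U V" and sides: "card U = m" "card V = n"
    using complete_bipartite_digraphE[OF assms] .
  then interpret complete_bipartite_graph G U V by simp
  obtain S where "geodetic_set G S" "card S = geodetic_number G"
    using minimum_geodetic_setE .
  with card_geodetic_set_ge sides show ?thesis by metis
qed

lemma geodetic_number_complete_bipartite_complete_le: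
  assumes "K\<^bsub>m,n\<^esub> (with_proj G)" "2 \<le> m" "2 \<le> n" and K: "K\<^bsub>p\<^esub> (with_proj H)" "0 < p"
  shows "geodetic_number (G \<boxtimes> H) \<le> 4"
proof -
  obtain U V where "complete_bipartite_graph G U V" and sides: "card U = m" "card V = n"
    using assms by (auto elim: complete_bipartite_digraphE)
  then interpret G: complete_bipartite_graph G U V by simp
  interpret connected_pair_graph_pair G H
    using G.connected_pair_graph_axioms connected_pair_graph_complete[OF K]
    by (simp add: connected_pair_graph_pair_def)
  obtain A where A: "A \<subseteq> U" "card A = 2"
    using obtain_subset_with_card_n assms(2) sides(1) by metis
  obtain B where B: "B \<subseteq> V" "card B = 2"
    using obtain_subset_with_card_n assms(3) sides(2) by metis
  obtain t where t: "t \<in> pverts H" using H.connected by (auto simp: connected_conv)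
  have "geodetic_set (G \<boxtimes> H) ((A \<union> B) \<times> {t})"
  proof (rule geodetic_set_Times_singleton)
    show AB: "A \<union> B \<subseteq> pverts G" using A(1) B(1) by (auto simp: G.verts_eq)
    fix g h assume gh: "g \<in> pverts G" "h \<in> pverts H"
    then obtain u v where uv: "u \<in> A \<union> B" "v \<in> A \<union> B" "g \<in> interval G u v" "u \<noteq> g" "v \<noteq> g"
      using G.strictly_between_two_per_sideE[OF A B] by metis
    have "hops H t h \<le> 1" "hops H h t \<le> 1"
      using H.hops_le_1_if_complete[OF K(1)] t gh(2) by simp_all
    moreover have "1 \<le> hops G u g" "1 \<le> hops G g v"
      using uv gh(1) AB by (auto simp: Suc_le_eq G.hops_eq_0_iff simp flip: neq0_conv)
    ultimately show "\<exists>s\<in>A \<union> B. \<exists>s'\<in>A \<union> B. g \<in> interval G s s' \<and>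
        hops H t h \<le> hops G s g \<and> hops H h t \<le> hops G g s'"
      using uv(1-3) by (meson order_trans)
  qed (rule t)
  then have "geodetic_number (G \<boxtimes> H) \<le> card ((A \<union> B) \<times> {t})" by (rule GH.geodetic_number_le)
  also have "\<dots> \<le> card A + card B" by (simp add: card_cartesian_product card_Un_le)
  finally show ?thesis using A(2) B(2) by simp
qed

lemma nontrivial_connected_graph_complete:
  assumes "K\<^bsub>n\<^esub> (with_proj G)" "2 \<le> n"
  shows "nontrivial_connected_graph G"
proof -
  interpret connected_pair_graph G
    using assms(2) by (intro connected_pair_graph_complete[OF assms(1)]) simp
  show ?thesis
    using assms pair_graph connected
    by (simp add: nontrivial_connected_graph_def complete_digraph_pair_def)
qed

lemma nontrivial_connected_graph_complete_bipartite:
  assumes "K\<^bsub>m,n\<^esub> (with_proj G)" "0 < m" "0 < n"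
  shows "nontrivial_connected_graph G"
proof -
  obtain U V where "complete_bipartite_graph G U V" and sides: "card U = m" "card V = n"
    using complete_bipartite_digraphE[OF assms] .
  then interpret complete_bipartite_graph G U V by simp
  have "card (pverts G) = m + n"
    using sides disjoint assms by (simp add: verts_eq card_Un_disjoint card_ge_0_finite)
  then show ?thesis
    using assms pair_graph connected by (simp add: nontrivial_connected_graph_def)
qed

lemma ex_complete_digraph: "\<exists>G :: nat pair_pre_digraph. K\<^bsub>n\<^esub> (with_proj G)"
proof
  show "K\<^bsub>n\<^esub> (with_proj \<lparr>pverts = {..<n}, parcs = {(u, v). (u, v) \<in> {..<n} \<times> {..<n} \<and> u \<noteq> v}\<rparr>)"
    by (simp add: complete_digraph_pair_def)
qed

lemma ex_complete_bipartite_digraph: "\<exists>G :: nat pair_pre_digraph. K\<^bsub>m,n\<^esub> (with_proj G)"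
proof
  let ?U = "{..<m}" and ?V = "{m..<m + n}"
  have "?U \<inter> ?V = {}" "card ?U = m" "card ?V = n" by auto
  then show "K\<^bsub>m,n\<^esub> (with_proj \<lparr>pverts = ?U \<union> ?V, parcs = ?U \<times> ?V \<union> ?V \<times> ?U\<rparr>)"
    unfolding complete_bipartite_digraph_pair_def
    by (intro conjI exI[of _ ?U] exI[of _ ?V]) simp_all
qed

lemma min_geodetic_number_eq_complete_bipartite_complete:
  assumes G: "K\<^bsub>m,n\<^esub> (with_proj G)" and H: "K\<^bsub>p\<^esub> (with_proj H)"
    and "4 \<le> m" "4 \<le> n" "4 \<le> p"
  shows "min (geodetic_number G) (geodetic_number H) = geodetic_number (G \<boxtimes> H)"
proof (rule antisym)
  have "4 \<le> geodetic_number G" "geodetic_number H = p"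
    using geodetic_number_complete_bipartite_ge[OF G] geodetic_number_complete[OF H] assms(3-5)
    by simp_all
  moreover have "geodetic_number (G \<boxtimes> H) \<le> 4"
    using geodetic_number_complete_bipartite_complete_le[OF G _ _ H] assms(3-5) by simp
  ultimately show "geodetic_number (G \<boxtimes> H) \<le> min (geodetic_number G) (geodetic_number H)"
    using assms(5) by simp
  show "min (geodetic_number G) (geodetic_number H) \<le> geodetic_number (G \<boxtimes> H)"
    using nontrivial_connected_graph_complete_bipartite[OF G]
      nontrivial_connected_graph_complete[OF H] assms(3-5)
    by (intro geodetic_number_strong_product_bounds(1)) simp_all
qed

lemma geodetic_number_strong_product_complete:
  assumes "K\<^bsub>m\<^esub> (with_proj G)" "K\<^bsub>n\<^esub> (with_proj H)" "0 < m" "0 < n"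
  shows "geodetic_number (G \<boxtimes> H) = geodetic_number G * geodetic_number H"
  using assms complete_strong_product[of m G n H] by (simp add: geodetic_number_complete)

theorem theorem1:
  shows "(\<forall>(G :: 'a pair_pre_digraph) (H :: 'b pair_pre_digraph).
            nontrivial_connected_graph G \<and> nontrivial_connected_graph H \<longrightarrow>
              min (geodetic_number G) (geodetic_number H) \<le> geodetic_number (G \<boxtimes> H) \<and>
              geodetic_number (G \<boxtimes> H) \<le> geodetic_number G * geodetic_number H) \<and>
         (\<exists>(G :: nat pair_pre_digraph) (H :: nat pair_pre_digraph).
            nontrivial_connected_graph G \<and> nontrivial_connected_graph H \<and>
            min (geodetic_number G) (geodetic_number H) = geodetic_number (G \<boxtimes> H)) \<and>
         (\<exists>(G :: nat pair_pre_digraph) (H :: nat pair_pre_digraph).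
            nontrivial_connected_graph G \<and> nontrivial_connected_graph H \<and>
            geodetic_number (G \<boxtimes> H) = geodetic_number G * geodetic_number H)"
proof (intro conjI allI impI; (elim conjE)?)
  fix G :: "'a pair_pre_digraph" and H :: "'b pair_pre_digraph"
  assume "nontrivial_connected_graph G" "nontrivial_connected_graph H"
  then show "min (geodetic_number G) (geodetic_number H) \<le> geodetic_number (G \<boxtimes> H)"
    and "geodetic_number (G \<boxtimes> H) \<le> geodetic_number G * geodetic_number H"
    by (rule geodetic_number_strong_product_bounds)+
next
  obtain G H :: "nat pair_pre_digraph" where G: "K\<^bsub>4,4\<^esub> (with_proj G)" and H: "K\<^bsub>4\<^esub> (with_proj H)"
    using ex_complete_bipartite_digraph ex_complete_digraph by metis
  show "\<exists>(G :: nat pair_pre_digraph) (H :: nat pair_pre_digraph).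
      nontrivial_connected_graph G \<and> nontrivial_connected_graph H \<and>
      min (geodetic_number G) (geodetic_number H) = geodetic_number (G \<boxtimes> H)"
    using nontrivial_connected_graph_complete_bipartite[OF G]
      nontrivial_connected_graph_complete[OF H]
      min_geodetic_number_eq_complete_bipartite_complete[OF G H]
    by (intro exI[of _ G] exI[of _ H]) simp
next
  obtain G :: "nat pair_pre_digraph" where G: "K\<^bsub>2\<^esub> (with_proj G)"
    using ex_complete_digraph by metis
  show "\<exists>(G :: nat pair_pre_digraph) (H :: nat pair_pre_digraph).
      nontrivial_connected_graph G \<and> nontrivial_connected_graph H \<and>
      geodetic_number (G \<boxtimes> H) = geodetic_number G * geodetic_number H"
    using nontrivial_connected_graph_complete[OF G] geodetic_number_strong_product_complete[OF G G]
    by (intro exI[of _ G]) simp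
qed

end
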